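(* Let $f$ be a rational function in two variables and let $\Delta=\partial_x^2+\partial_y^2+\partial_z^2$ be the Laplace operator associated with the algebra $U(u(2)_\hbar)$. Then $$\Delta(f(t,\mu))=\frac1{\hbar^2}\Bigl(2f(t+\hbar,\mu)-f(t+\hbar,\mu-2\hbar)-f(t+\hbar,\mu+2\hbar)\Bigr)+\frac2{\mu\hbar}\Bigl(f(t+\hbar,\mu-2\hbar)-f(t+\hbar,\mu+2\hbar)\Bigr).$$
   Context: Fix $\hbar\ne0$. The complexified algebra $U(u(2)_\hbar)$ is generated by $x,y,z,t$ with $[x,y]=\hbar z$, $[y,z]=\hbar x$, $[z,x]=\hbar y$, and $t$ central; $\mathrm{Cas}=x^2+y^2+z^2$. Partial derivatives $\partial_x,\partial_y,\partial_z$ and $\tilde\partial_t=\partial_t+\frac2\hbar$ commute with each other and satisfy the permutation relations $[\tilde\partial_t,t]=\frac\hbar2\tilde\partial_t$, $[\tilde\partial_t,x]=-\frac\hbar2\partial_x$, $[\tilde\partial_t,y]=-\frac\hbar2\partial_y$, $[\tilde\partial_t,z]=-\frac\hbar2\partial_z$; $[\partial_g,t]=\frac\hbar2\partial_g$ and $[\partial_g,g]=\frac\hbar2\tilde\partial_t$ for $g\in\{x,y,z\}$; $[\partial_x,y]=\frac\hbar2\partial_z$, $[\partial_x,z]=-\frac\hbar2\partial_y$, $[\partial_y,x]=-\frac\hbar2\partial_z$, $[\partial_y,z]=\frac\hbar2\partial_x$, $[\partial_z,x]=\frac\hbar2\partial_y$, $[\partial_z,y]=-\frac\hbar2\partial_x$.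 They act by moving derivatives to the right and evaluating on $1$: $\partial_x(1)=\partial_y(1)=\partial_z(1)=\partial_t(1)=0$, so $\tilde\partial_t(1)=\frac2\hbar$. Put $Q=x\partial_x+y\partial_y+z\partial_z$, $\Delta_0=\tilde\partial_t^2$, $\Delta_1=\Delta$, $\Delta_2=Q\tilde\partial_t$, $\Delta_3=Q^2$. The element $\mu$ is a central element, in an algebraic extension of the center, with $\mu^2=\hbar^2-4\,\mathrm{Cas}$. Extension of the action to rational functions of $t,\mu$. One has $\Delta_i\,t^m=(t+\hbar)^m\Delta_i$ and $\Delta_i\,\mathrm{Cas}=\sum_{j=0}^3\Pi_{ij}\Delta_j$ with $$\Pi=\begin{pmatrix}\mathrm{Cas}-\frac32\hbar^2&\frac{\hbar^2}2&-2\hbar&0\\ \frac32\hbar^2&\mathrm{Cas}-\frac{\hbar^2}2&2\hbar&0\\ \hbar\,\mathrm{Cas}&0&\mathrm{Cas}-\frac{\hbar^2}2&-\hbar\\ \hbar^2\mathrm{Cas}&-\frac{\hbar^2}2\mathrm{Cas}&\hbar(2\mathrm{Cas}+\frac{\hbar^2}4)&\mathrm{Cas}+\frac{\hbar^2}2\end{pmatrix}.$$ $\Pi$ is diagonalizable with eigenvalues $\lambda_0=\frac14(\hbar^2-\mu^2)$ (double) and $\lambda_\pm=\frac14(\hbar^2-(\mu\pm2\hbar)^2)$; let $P_0,P_+,P_-$ be its spectral projectors. Functions of $\mu=\sqrt{\hbar^2-4\,\mathrm{Cas}}$ are moved through the $\Delta_i$ with the branches $\sqrt{\hbar^2-4\lambda_0}=\mu$,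 $\sqrt{\hbar^2-4\lambda_\pm}=\mu\pm2\hbar$; that is, the action is defined by $$\Delta_i(f(t,\mu))=\sum_{j=0}^3\bigl(f(t+\hbar,\mu)P_0+f(t+\hbar,\mu+2\hbar)P_++f(t+\hbar,\mu-2\hbar)P_-\bigr)_{ij}\,\Delta_j(1).$$ *)

theory Defs
  imports
    Complex_Main
    "HOL-Library.Poly_Mapping"
    "HOL-Computational_Algebra.Computational_Algebra"
    "HOL-Algebra.QuotRing"
    "HOL-Algebra.Algebraic_Closure_Type"
    "Jordan_Normal_Form.Matrix"
begin

section \<open>Free associative algebras\<close>

text \<open>
  Words form a monoid under concatenation, so \<^typ>\<open>'g list \<Rightarrow>\<^sub>0 'k\<close> with the convolution product
  of \<^theory>\<open>HOL-Library.Poly_Mapping\<close> is the free associative \<open>'k\<close>-algebra on \<open>'g\<close>.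
\<close>

instantiation list :: (type) monoid_add
begin
definition "0 = ([] :: 'a list)"
definition "u + v = (u @ v :: 'a list)"
instance by standard (auto simp: zero_list_def plus_list_def)
end

datatype gen = gX | gY | gZ | gT

type_synonym 'k falg = "gen list \<Rightarrow>\<^sub>0 'k"

definition gvar :: "gen \<Rightarrow> 'k::comm_ring_1 falg"
  where "gvar g = Poly_Mapping.single [g] 1"

definition const :: "'k::comm_ring_1 \<Rightarrow> 'k falg"
  where "const c = Poly_Mapping.single [] c"

abbreviation Falg :: "'k::comm_ring_1 falg ring"
  where "Falg \<equiv> ring_of_type_algebra"

section \<open>The algebra \<open>U(u(2)\<^sub>\<hbar>)\<close>\<close>

definition commutator :: "'a::ring \<Rightarrow> 'a \<Rightarrow> 'a"
  where "commutator a b = a * b - b * a"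

definition u2_relators :: "'k::comm_ring_1 \<Rightarrow> 'k falg set"
  where "u2_relators h =
    {commutator (gvar gX) (gvar gY) - const h * gvar gZ,
     commutator (gvar gY) (gvar gZ) - const h * gvar gX,
     commutator (gvar gZ) (gvar gX) - const h * gvar gY,
     commutator (gvar gT) (gvar gX), commutator (gvar gT) (gvar gY), commutator (gvar gT) (gvar gZ)}"

definition casimir :: "'k::comm_ring_1 falg"
  where "casimir = gvar gX ^ 2 + gvar gY ^ 2 + gvar gZ ^ 2"

definition U_ideal :: "complex \<Rightarrow> complex falg set"
  where "U_ideal h = genideal Falg (u2_relators h)"

definition U :: "complex \<Rightarrow> complex falg set ring"
  where "U h = Falg Quot U_ideal h"

definition U_class :: "complex \<Rightarrow> complex falg \<Rightarrow> complex falg set"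
  where "U_class h u = U_ideal h +>\<^bsub>Falg\<^esub> u"

section \<open>Partial derivatives\<close>

text \<open>
  \<open>DT\<close> stands for the shifted derivative \<open>\<partial>\<^sub>t + 2/\<hbar>\<close>.  The permutation relation of a
  derivative \<open>D\<close> and a generator \<open>g\<close> is \<open>[D, g] = s (\<hbar>/2) D'\<close> with \<open>(s, D') = perm_rel D g\<close>.
\<close>

datatype deriv = DX | DY | DZ | DT

fun perm_rel :: "deriv \<Rightarrow> gen \<Rightarrow> int \<times> deriv"
  where
    "perm_rel DT gT = (1, DT)" | "perm_rel DT gX = (-1, DX)" | "perm_rel DT gY = (-1, DY)" | "perm_rel DT gZ = (-1, DZ)"
  | "perm_rel DX gT = (1, DX)" | "perm_rel DX gX = (1, DT)"  | "perm_rel DX gY = (1, DZ)"  | "perm_rel DX gZ = (-1, DY)"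
  | "perm_rel DY gT = (1, DY)" | "perm_rel DY gX = (-1, DZ)" | "perm_rel DY gY = (1, DT)"  | "perm_rel DY gZ = (1, DX)"
  | "perm_rel DZ gT = (1, DZ)" | "perm_rel DZ gX = (1, DY)"  | "perm_rel DZ gY = (-1, DX)" | "perm_rel DZ gZ = (1, DT)"

text \<open>Values on the unit; \<open>\<partial>\<^sub>t(1) = 0\<close> amounts to \<open>DT(1) = 2/\<hbar>\<close>.\<close>

definition counit :: "complex \<Rightarrow> deriv \<Rightarrow> complex"
  where "counit h D = (if D = DT then 2 / h else 0)"

text \<open>
  The action on a word moves the derivative to the right, one letter at a time:
  \<open>D g = g D + [D, g]\<close>.  At the empty word it is evaluated on \<open>1\<close>.
\<close>

primrec pd_word :: "complex \<Rightarrow> gen list \<Rightarrow> deriv \<Rightarrow> complex falg"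
  where
    "pd_word h [] D = const (counit h D)"
  | "pd_word h (g # w) D = gvar g * pd_word h w D +
       (case perm_rel D g of (s, D') \<Rightarrow> const (of_int s * (h / 2)) * pd_word h w D')"

definition pd_free :: "complex \<Rightarrow> deriv \<Rightarrow> complex falg \<Rightarrow> complex falg"
  where "pd_free h D u =
    (\<Sum>w\<in>Poly_Mapping.keys u. const (Poly_Mapping.lookup u w) * pd_word h w D)"

text \<open>
  The induced operators on \<open>U(u(2)\<^sub>\<hbar>)\<close>.  They are well defined (\<open>pd_class\<close>), satisfy the permutation
  relations (\<open>pd_permutation\<close>) and commute (\<open>pd_commute\<close>).
\<close>

definition pd :: "complex \<Rightarrow> deriv \<Rightarrow> complex falg set \<Rightarrow> complex falg set"
  where "pd h D a = the_elem ((\<lambda>u. U_class h (pd_free h D u)) ` a)"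

definition laplacian :: "complex \<Rightarrow> complex falg set \<Rightarrow> complex falg set"
  where "laplacian h a =
    pd h DX (pd h DX a) \<oplus>\<^bsub>U h\<^esub> pd h DY (pd h DY a) \<oplus>\<^bsub>U h\<^esub> pd h DZ (pd h DZ a)"

definition Qop :: "complex \<Rightarrow> complex falg set \<Rightarrow> complex falg set"
  where "Qop h a =
    U_class h (gvar gX) \<otimes>\<^bsub>U h\<^esub> pd h DX a \<oplus>\<^bsub>U h\<^esub>
    U_class h (gvar gY) \<otimes>\<^bsub>U h\<^esub> pd h DY a \<oplus>\<^bsub>U h\<^esub>
    U_class h (gvar gZ) \<otimes>\<^bsub>U h\<^esub> pd h DZ a"

definition Delta :: "complex \<Rightarrow> nat \<Rightarrow> complex falg set \<Rightarrow> complex falg set"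
  where "Delta h i =
    [\<lambda>a. pd h DT (pd h DT a), laplacian h, \<lambda>a. Qop h (pd h DT a), \<lambda>a. Qop h (Qop h a)] ! i"

section \<open>Rational functions of \<open>t\<close> and \<open>\<mu>\<close>\<close>

text \<open>The field \<open>\<complex>(t, \<mu>)\<close>; the inner polynomial variable is \<open>t\<close>, the outer one is \<open>\<mu>\<close>.\<close>

type_synonym ratfun = "complex poly poly fract"

definition rf_const :: "complex \<Rightarrow> ratfun"
  where "rf_const c = Fraction_Field.Fract [:[:c:]:] 1"

definition rf_t :: ratfun
  where "rf_t = Fraction_Field.Fract [:[:0, 1:]:] 1"

definition rf_mu :: ratfun
  where "rf_mu = Fraction_Field.Fract [:0, 1:] 1"

definition poly_subst :: "complex poly poly \<Rightarrow> ratfun \<Rightarrow> ratfun \<Rightarrow> ratfun"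
  where "poly_subst p a b = poly (map_poly (\<lambda>c. poly (map_poly rf_const c) a) p) b"

text \<open>
  The rational function \<open>f(a, b)\<close>.  It is only used at \<open>a = t + \<hbar>\<close>, \<open>b = \<mu> + c\<close> with \<open>c\<close> a constant,
  where no nonzero polynomial vanishes.
\<close>

definition rf_subst :: "ratfun \<Rightarrow> ratfun \<Rightarrow> ratfun \<Rightarrow> ratfun"
  where "rf_subst f a b =
    (case quot_of_fract f of (p, q) \<Rightarrow> poly_subst p a b / poly_subst q a b)"

section \<open>Adjoining rational functions of \<open>t\<close> and \<open>\<mu>\<close> to the algebra\<close>

text \<open>
  Over the coefficient field \<open>\<complex>(t, \<mu>)\<close>, identify the generator \<open>gT\<close> with \<open>t\<close> and impose
  \<open>\<mu>\<^sup>2 = \<hbar>\<^sup>2 - 4 Cas\<close>.  This is \<open>U(u(2)\<^sub>\<hbar>)\<close> with its central subalgebra \<open>\<complex>[t, Cas]\<close>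
  extended to the field \<open>\<complex>(t, \<mu>)\<close>.
\<close>

definition A_ideal :: "complex \<Rightarrow> ratfun falg set"
  where "A_ideal h = genideal Falg
    (u2_relators (rf_const h) \<union>
     {gvar gT - const rf_t, const (rf_mu ^ 2) - (const (rf_const h ^ 2) - 4 * casimir)})"

definition A :: "complex \<Rightarrow> ratfun falg set ring"
  where "A h = Falg Quot A_ideal h"

definition A_class :: "complex \<Rightarrow> ratfun falg \<Rightarrow> ratfun falg set"
  where "A_class h u = A_ideal h +>\<^bsub>Falg\<^esub> u"

definition rf_to_A :: "complex \<Rightarrow> ratfun \<Rightarrow> ratfun falg set"
  where "rf_to_A h r = A_class h (const r)"

text \<open>The homomorphism that extends coefficients; it is well defined by \<open>U_to_A_class\<close>.\<close>

definition U_to_A :: "complex \<Rightarrow> complex falg set \<Rightarrow> ratfun falg set"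
  where "U_to_A h a = the_elem ((\<lambda>u. A_class h (Poly_Mapping.map rf_const u)) ` a)"

section \<open>The action on rational functions\<close>

text \<open>
  Passing \<open>\<Delta>\<^sub>i\<close> through a function of \<open>t\<close> and \<open>\<mu>\<close> shifts \<open>t\<close> by \<open>\<hbar>\<close>, since \<open>\<Delta>\<^sub>i t = (t + \<hbar>) \<Delta>\<^sub>i\<close>, and
  replaces \<open>Cas\<close> by the matrix \<open>\<Pi>\<close> in \<open>\<Delta>\<^sub>i Cas = \<Sum>\<^sub>j \<Pi>\<^sub>i\<^sub>j \<Delta>\<^sub>j\<close>; functions of \<open>\<mu>\<close> are applied to \<open>\<Pi>\<close> by
  spectral calculus.
\<close>

text \<open>
  For a diagonalizable matrix, the projector onto the eigenspace of \<open>l\<close> along the sum of the other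
  eigenspaces.
\<close>

definition spectral_projector :: "'k::field mat \<Rightarrow> 'k \<Rightarrow> 'k mat"
  where "spectral_projector M l = (THE P. P \<in> carrier_mat (dim_row M) (dim_row M) \<and>
    (\<forall>v \<in> carrier_vec (dim_row M). M *\<^sub>v v = l \<cdot>\<^sub>v v \<longrightarrow> P *\<^sub>v v = v) \<and>
    (\<forall>k. \<forall>v \<in> carrier_vec (dim_row M).
       k \<noteq> l \<longrightarrow> M *\<^sub>v v = k \<cdot>\<^sub>v v \<longrightarrow> P *\<^sub>v v = 0\<^sub>v (dim_row M)))"

definition rf_Cas :: "complex \<Rightarrow> ratfun"
  where "rf_Cas h = (rf_const h ^ 2 - rf_mu ^ 2) / 4"

definition Pi_mat :: "complex \<Rightarrow> ratfun mat"
  where "Pi_mat h = (let C = rf_Cas h; h = rf_const h in mat_of_rows_list 4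
    [[C - 3 / 2 * h ^ 2, h ^ 2 / 2,         - 2 * h,                    0],
     [3 / 2 * h ^ 2,     C - h ^ 2 / 2,     2 * h,                      0],
     [h * C,             0,                 C - h ^ 2 / 2,              - h],
     [h ^ 2 * C,         - (h ^ 2 / 2) * C, h * (2 * C + h ^ 2 / 4),    C + h ^ 2 / 2]])"

text \<open>
  \<open>branch_eigenvalue h m\<close> is the eigenvalue \<open>l\<close> of \<open>\<Pi>\<close> for which \<open>m\<close> is the chosen branch of \<open>\<surd>(\<hbar>\<^sup>2 - 4 l)\<close>.
\<close>

definition branch_eigenvalue :: "complex \<Rightarrow> ratfun \<Rightarrow> ratfun"
  where "branch_eigenvalue h m = (rf_const h ^ 2 - m ^ 2) / 4"

definition transfer_mat :: "complex \<Rightarrow> ratfun \<Rightarrow> ratfun mat"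
  where "transfer_mat h f =
    (let term = (\<lambda>m. rf_subst f (rf_t + rf_const h) m \<cdot>\<^sub>m
                     spectral_projector (Pi_mat h) (branch_eigenvalue h m))
     in term rf_mu + term (rf_mu + 2 * rf_const h) + term (rf_mu - 2 * rf_const h))"

definition rf_action :: "complex \<Rightarrow> nat \<Rightarrow> ratfun \<Rightarrow> ratfun falg set"
  where "rf_action h i f = (\<Oplus>\<^bsub>A h\<^esub> j \<in> {0..<4}.
    rf_to_A h (transfer_mat h f $$ (i, j)) \<otimes>\<^bsub>A h\<^esub> U_to_A h (Delta h j \<one>\<^bsub>U h\<^esub>))"

section \<open>Well-definedness of the induced maps and the relations of the derivatives\<close>

lemma poly_mapping_single_induct [case_names single sum]:
  fixes u :: "'a \<Rightarrow>\<^sub>0 'b::comm_monoid_add"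
  assumes single: "\<And>w a. P (Poly_Mapping.single w a)"
    and sum: "\<And>u v. P u \<Longrightarrow> P v \<Longrightarrow> P (u + v)"
  shows "P u"
proof (induction u rule: update_induct)
  case const
  then show ?case using single[of undefined 0] by simp
next
  case (update f a b)
  have "Poly_Mapping.update a b f = f + Poly_Mapping.single a b"
    using update(1) by (intro poly_mapping_eqI) (auto simp: lookup_update lookup_add lookup_single in_keys_iff when_def)
  with sum[OF update(3) single] show ?case by simp
qed

lemma Falg_simps:
  "carrier (Falg :: 'k::comm_ring_1 falg ring) = UNIV"
  "monoid.mult (Falg :: 'k falg ring) = (*)" "ring.add (Falg :: 'k falg ring) = (+)"
  "one (Falg :: 'k falg ring) = 1" "zero (Falg :: 'k falg ring) = 0"
  by (auto simp: ring_of_type_algebra_def)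

lemma Falg_ring: "ring (Falg :: 'k::comm_ring_1 falg ring)"
proof -
  have "\<exists>y. x + y = 0" for x :: "'k falg"
    by (rule exI[of _ "- x"]) simp
  moreover have "\<exists>y. y + x = 0" for x :: "'k falg"
    by (rule exI[of _ "- x"]) simp
  ultimately show ?thesis
    by (unfold_locales) (auto simp: ring_of_type_algebra_def algebra_simps Units_def)
qed

lemma genideal_Falg: "ideal (genideal Falg S) (Falg :: 'k::comm_ring_1 falg ring)"
  by (rule ring.genideal_ideal[OF Falg_ring]) (simp add: Falg_simps)

lemma Falg_a_inv: "a_inv (Falg :: 'k::comm_ring_1 falg ring) x = - x"
proof -
  interpret ring "Falg :: 'k falg ring" by (rule Falg_ring)
  show ?thesis by (rule minus_equality) (simp_all add: Falg_simps)
qed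

lemma genideal_closed:
  fixes S :: "'k::comm_ring_1 falg set"
  assumes "x \<in> genideal Falg S"
  shows "a * x \<in> genideal Falg S" "x * a \<in> genideal Falg S" "- x \<in> genideal Falg S"
    and "y \<in> genideal Falg S \<Longrightarrow> x + y \<in> genideal Falg S"
proof -
  interpret ideal "genideal Falg S" "Falg :: 'k falg ring" by (rule genideal_Falg)
  show "a * x \<in> genideal Falg S" "x * a \<in> genideal Falg S"
    using I_l_closed[OF assms, of a] I_r_closed[OF assms, of a] by (simp_all add: Falg_simps)
  show "- x \<in> genideal Falg S"
    using additive_subgroup.a_inv_closed[OF is_additive_subgroup assms] by (simp add: Falg_a_inv)
  show "x + y \<in> genideal Falg S" if "y \<in> genideal Falg S"
    using additive_subgroup.a_closed[OF is_additive_subgroup assms that] by (simp add: Falg_simps)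
qed

lemma genideal_zero: "0 \<in> genideal Falg (S :: 'k::comm_ring_1 falg set)"
proof -
  interpret ideal "genideal Falg S" "Falg :: 'k falg ring" by (rule genideal_Falg)
  show ?thesis using additive_subgroup.zero_closed[OF is_additive_subgroup] by (simp add: Falg_simps)
qed

lemma genideal_superset: "S \<subseteq> genideal Falg (S :: 'k::comm_ring_1 falg set)"
  by (rule ring.genideal_self[OF Falg_ring]) (simp add: Falg_simps)

lemma genideal_least:
  fixes J :: "'k::comm_ring_1 falg set"
  assumes "S \<subseteq> J" "0 \<in> J" "\<And>x y. x \<in> J \<Longrightarrow> y \<in> J \<Longrightarrow> x + y \<in> J"
    and "\<And>a x. x \<in> J \<Longrightarrow> a * x \<in> J" "\<And>a x. x \<in> J \<Longrightarrow> x * a \<in> J"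
  shows "genideal Falg S \<subseteq> J"
proof (rule ring.genideal_minimal[OF Falg_ring])
  have m: "- x \<in> J" if "x \<in> J" for x
    using assms(4)[OF that, of "- 1"] by simp
  have i: "inv\<^bsub>add_monoid (Falg :: 'k falg ring)\<^esub> x = - x" for x
    using Falg_a_inv[of x] by (simp add: a_inv_def)
  show "ideal J Falg"
  proof (rule idealI)
    show "subgroup J (add_monoid (Falg :: 'k falg ring))"
      by (rule subgroup.intro) (unfold i, auto simp: Falg_simps assms m)
  qed (auto simp: Falg_simps assms Falg_ring)
qed (rule assms)

lemma coset_eq_iff:
  fixes S :: "'k::comm_ring_1 falg set"
  shows "genideal Falg S +>\<^bsub>Falg\<^esub> u = genideal Falg S +>\<^bsub>Falg\<^esub> v \<longleftrightarrow> u - v \<in> genideal Falg S"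
proof -
  interpret ideal "genideal Falg S" "Falg :: 'k falg ring" by (rule genideal_Falg)
  show ?thesis
    using quotient_eq_iff_same_a_r_cos[OF genideal_Falg, of u v S]
    by (simp add: a_minus_def Falg_a_inv Falg_simps eq_commute)
qed

lemma mem_coset_iff:
  fixes S :: "'k::comm_ring_1 falg set"
  shows "v \<in> genideal Falg S +>\<^bsub>Falg\<^esub> u \<longleftrightarrow> v - u \<in> genideal Falg S"
  by (auto simp: a_r_coset_def' Falg_simps image_iff diff_eq_eq)
     (metis diff_add_cancel)

lemma U_class_eq_iff: "U_class h u = U_class h v \<longleftrightarrow> u - v \<in> U_ideal h"
  unfolding U_class_def U_ideal_def by (rule coset_eq_iff)

lemma A_class_eq_iff: "A_class h u = A_class h v \<longleftrightarrow> u - v \<in> A_ideal h"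
  unfolding A_class_def A_ideal_def by (rule coset_eq_iff)

lemma mem_U_class_iff: "v \<in> U_class h u \<longleftrightarrow> v - u \<in> U_ideal h"
  unfolding U_class_def U_ideal_def by (rule mem_coset_iff)

lemma U_class_add: "U_class h u \<oplus>\<^bsub>U h\<^esub> U_class h v = U_class h (u + v)"
proof -
  interpret ideal "U_ideal h" "Falg :: complex falg ring" unfolding U_ideal_def by (rule genideal_Falg)
  show ?thesis
    using a_rcos_sum[of u v] by (simp add: U_class_def U_def FactRing_def Falg_simps)
qed

lemma U_class_mult: "U_class h u \<otimes>\<^bsub>U h\<^esub> U_class h v = U_class h (u * v)"
proof -
  interpret ideal "U_ideal h" "Falg :: complex falg ring" unfolding U_ideal_def by (rule genideal_Falg)
  show ?thesis
    using rcoset_mult_add[of u v] by (simp add: U_class_def U_def FactRing_def Falg_simps)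
qed

lemma const_add: "const (a + b) = const a + const b"
  by (simp add: const_def single_add)

lemma const_mult: "const (a * b) = const a * const b"
  by (simp add: const_def mult_single plus_list_def)

lemma const_0 [simp]: "const 0 = 0"
  by (simp add: const_def)

lemma const_1 [simp]: "const 1 = 1"
  by (simp add: const_def zero_list_def[symmetric])

lemma const_uminus: "const (- a) = - const a"
  by (simp add: const_def single_uminus)

lemma const_commute: "const c * u = u * const c"
proof (induction u rule: poly_mapping_single_induct)
  case (single w a)
  then show ?case by (simp add: const_def mult_single plus_list_def mult.commute)
next
  case (sum u v)
  then show ?case by (simp add: distrib_left distrib_right)
qed

lemma pd_free_superset:
  assumes "finite S" "Poly_Mapping.keys u \<subseteq> S"
  shows "pd_free h D u = (\<Sum>w\<in>S. const (Poly_Mapping.lookup u w) * pd_word h w D)"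
  unfolding pd_free_def
  by (rule sum.mono_neutral_left) (use assms in \<open>auto simp: in_keys_iff\<close>)

lemma pd_free_add: "pd_free h D (u + v) = pd_free h D u + pd_free h D v"
proof -
  let ?S = "Poly_Mapping.keys u \<union> Poly_Mapping.keys v"
  have *: "Poly_Mapping.keys (u + v) \<subseteq> ?S" by (rule Poly_Mapping.keys_add)
  show ?thesis
    by (simp add: pd_free_superset[of ?S] * lookup_add const_add distrib_right sum.distrib)
qed

lemma pd_free_single: "pd_free h D (Poly_Mapping.single w c) = const c * pd_word h w D"
  by (simp add: pd_free_def)

lemma pd_free_0 [simp]: "pd_free h D 0 = 0"
  by (simp add: pd_free_def)

lemma pd_free_const_mult: "pd_free h D (const c * u) = const c * pd_free h D u"
proof (induction u rule: poly_mapping_single_induct)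
  case (single w a)
  have "const c * Poly_Mapping.single w a = Poly_Mapping.single w (c * a)"
    by (simp add: const_def mult_single plus_list_def)
  then show ?case by (simp add: pd_free_single const_mult mult.assoc)
next
  case (sum u v)
  then show ?case by (simp add: distrib_left pd_free_add)
qed

lemma pd_free_uminus: "pd_free h D (- u) = - pd_free h D u"
  using pd_free_const_mult[of h D "- 1" u] by (simp add: const_uminus)

lemma pd_free_diff: "pd_free h D (u - v) = pd_free h D u - pd_free h D v"
  using pd_free_add[of h D u "- v"] by (simp add: pd_free_uminus)

lemma pd_free_1: "pd_free h D 1 = const (counit h D)"
  using pd_free_single[of h D "[]" 1] by (simp flip: zero_list_def) (simp add: zero_list_def)

text \<open>The permutation relations.\<close>

lemma pd_free_gvar_mult:
  "pd_free h D (gvar g * u) = gvar g * pd_free h D u +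
     (case perm_rel D g of (s, D') \<Rightarrow> const (of_int s * (h / 2)) * pd_free h D' u)"
proof (induction u rule: poly_mapping_single_induct)
  case (single w a)
  obtain s D' where p: "perm_rel D g = (s, D')" by force
  have *: "const a * (gvar g * z) = gvar g * (const a * z)" for z
    by (metis const_commute mult.assoc)
  have **: "const a * (const b * z) = const b * (const a * z)" for b and z :: "complex falg"
    by (metis const_commute mult.assoc)
  have "gvar g * Poly_Mapping.single w a = Poly_Mapping.single (g # w) a"
    by (simp add: gvar_def mult_single plus_list_def)
  then show ?case by (simp add: pd_free_single p distrib_left * **)
next
  case (sum u v)
  then show ?case
    by (simp add: distrib_left pd_free_add split: prod.splits)
qed

lemma falg_induct [case_names zero add const gvar]:
  fixes u :: "'k::comm_ring_1 falg"
  assumes "P 1" "\<And>u v. P u \<Longrightarrow> P v \<Longrightarrow> P (u + v)"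
    and "\<And>c u. P u \<Longrightarrow> P (const c * u)" "\<And>g u. P u \<Longrightarrow> P (gvar g * u)"
  shows "P u"
proof (induction u rule: poly_mapping_single_induct)
  case (single w a)
  have "P (Poly_Mapping.single w 1)"
  proof (induction w)
    case Nil
    then show ?case using assms(1) by (simp add: zero_list_def[symmetric])
  next
    case (Cons g w)
    have "gvar g * Poly_Mapping.single w (1::'k) = Poly_Mapping.single (g # w) 1"
      by (simp add: gvar_def mult_single plus_list_def)
    with assms(4)[OF Cons, of g] show ?case by simp
  qed
  from assms(3)[OF this, of a] show ?case
    by (simp add: const_def mult_single plus_list_def)
next
  case (sum u v)
  then show ?case by (simp add: assms(2))
qed

lemma pd_free_relator:
  assumes "r \<in> u2_relators h"
  shows "pd_free h D (r * b) = r * pd_free h D b"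
proof -
  have c: "gvar g * (const a * z) = const a * (gvar g * z)" for a g and z :: "complex falg"
    by (metis const_commute mult.assoc)
  have c1: "gvar g * const a = const a * (gvar g :: complex falg)" for a g
    by (metis const_commute)
  have h: "const h * (const (h / 2) * z) =
      const (h / 2) * (const (h / 2) * z) + const (h / 2) * (const (h / 2) * z)" for z
    by (simp flip: distrib_right const_add)
  show ?thesis
    using assms unfolding u2_relators_def commutator_def
    by (cases D)
      (auto simp: left_diff_distrib mult.assoc pd_free_diff pd_free_gvar_mult pd_free_const_mult
        distrib_left right_diff_distrib c c1 h const_uminus)
qed

lemma pd_free_U_ideal:
  assumes "u \<in> U_ideal h"
  shows "pd_free h D u \<in> U_ideal h"
proof -
  let ?J = "{u. \<forall>D b. pd_free h D (u * b) \<in> U_ideal h}"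
  note cl = genideal_closed[where S = "u2_relators h", folded U_ideal_def]
  note z = genideal_zero[of "u2_relators h", folded U_ideal_def]
  have "genideal Falg (u2_relators h) \<subseteq> ?J"
  proof (rule genideal_least)
    show "u2_relators h \<subseteq> ?J"
      using genideal_superset[of "u2_relators h", folded U_ideal_def]
      by (auto simp: pd_free_relator intro!: cl(2))
    show "a * x \<in> ?J" if "x \<in> ?J" for a x
      using that
    proof (induction a arbitrary: x rule: falg_induct)
      case (gvar g u)
      then have "u * x \<in> ?J" by blast
      then show ?case
        by (auto simp: mult.assoc pd_free_gvar_mult intro!: cl(1) cl(4) split: prod.splits)
    qed (auto simp: mult.assoc distrib_right pd_free_add pd_free_const_mult intro!: cl(1) cl(4))
  qed (auto simp: z distrib_right pd_free_add mult.assoc intro!: cl(4))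
  with assms have "u \<in> ?J" unfolding U_ideal_def by blast
  then have "pd_free h D (u * 1) \<in> U_ideal h" by blast
  then show ?thesis by simp
qed

lemma pd_class: "pd h D (U_class h u) = U_class h (pd_free h D u)"
proof -
  have "(\<lambda>v. U_class h (pd_free h D v)) ` U_class h u = {U_class h (pd_free h D u)}"
  proof (intro equalityI subsetI)
    fix c assume "c \<in> (\<lambda>v. U_class h (pd_free h D v)) ` U_class h u"
    then obtain v where v: "v - u \<in> U_ideal h" "c = U_class h (pd_free h D v)"
      by (auto simp: mem_U_class_iff)
    have "U_class h (pd_free h D v) = U_class h (pd_free h D u)"
      unfolding U_class_eq_iff pd_free_diff[symmetric] using v(1) by (rule pd_free_U_ideal)
    with v(2) show "c \<in> {U_class h (pd_free h D u)}" by simp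
  next
    have "u \<in> U_class h u"
      by (simp add: mem_U_class_iff genideal_zero[of "u2_relators h", folded U_ideal_def])
    then show "c \<in> (\<lambda>v. U_class h (pd_free h D v)) ` U_class h u"
      if "c \<in> {U_class h (pd_free h D u)}" for c
      using that by blast
  qed
  then show ?thesis by (simp add: pd_def)
qed

lemma U_one: "\<one>\<^bsub>U h\<^esub> = U_class h 1"
  by (simp add: U_def FactRing_def U_class_def Falg_simps)

lemma U_carrier: "carrier (U h) = range (U_class h)"
  by (auto simp: U_def FactRing_def A_RCOSETS_def' U_class_def Falg_simps)

lemma pd_permutation:
  assumes "a \<in> carrier (U h)" "perm_rel D g = (s, D')"
  shows "pd h D (U_class h (gvar g) \<otimes>\<^bsub>U h\<^esub> a) =
    U_class h (gvar g) \<otimes>\<^bsub>U h\<^esub> pd h D a \<oplus>\<^bsub>U h\<^esub>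
    U_class h (const (of_int s * (h / 2))) \<otimes>\<^bsub>U h\<^esub> pd h D' a"
  using assms
  by (auto simp: U_carrier pd_class U_class_mult U_class_add pd_free_gvar_mult)

lemma pd_free_const: "pd_free h D (const c) = const (c * counit h D)"
  using pd_free_const_mult[of h D c 1] by (simp add: pd_free_1 const_mult)

lemma pd_free_commute: "pd_free h D (pd_free h E u) = pd_free h E (pd_free h D u)"
proof (induction u arbitrary: D E rule: falg_induct)
  case zero
  show ?case by (simp add: pd_free_1 pd_free_const mult.commute)
next
  case (gvar g u)
  obtain s D' s' E' where p: "perm_rel D g = (s, D')" "perm_rel E g = (s', E')"
    by (metis surj_pair)
  let ?c = "const (of_int s * (h / 2))" and ?c' = "const (of_int s' * (h / 2))"
  have "pd_free h D (pd_free h E (gvar g * u)) =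
      gvar g * pd_free h D (pd_free h E u) + ?c * pd_free h D' (pd_free h E u)
      + ?c' * pd_free h D (pd_free h E' u)"
    by (simp only: pd_free_gvar_mult p prod.case pd_free_add pd_free_const_mult)
  moreover have "pd_free h E (pd_free h D (gvar g * u)) =
      gvar g * pd_free h E (pd_free h D u) + ?c' * pd_free h E' (pd_free h D u)
      + ?c * pd_free h E (pd_free h D' u)"
    by (simp only: pd_free_gvar_mult p prod.case pd_free_add pd_free_const_mult)
  ultimately show ?case
    by (simp only: gvar[of D E] gvar[of D' E] gvar[of D E'] add.assoc add.commute add.left_commute)
qed (simp_all add: pd_free_add pd_free_const_mult)

lemma pd_commute:
  assumes "a \<in> carrier (U h)"
  shows "pd h D (pd h E a) = pd h E (pd h D a)"
  using assms by (auto simp: U_carrier pd_class pd_free_commute)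

lemma pd_one: "pd h D \<one>\<^bsub>U h\<^esub> = U_class h (const (counit h D))"
  by (simp add: U_one pd_class pd_free_1)

lemma rf_const_simps:
  "rf_const 0 = 0" "rf_const 1 = 1"
  "rf_const (a + b) = rf_const a + rf_const b" "rf_const (a * b) = rf_const a * rf_const b"
  by (simp_all add: rf_const_def Zero_fract_def One_fract_def one_pCons)

lemma map_rf_const_single [simp]:
  "Poly_Mapping.map rf_const (Poly_Mapping.single w c) = Poly_Mapping.single w (rf_const c)"
  by (simp add: rf_const_simps)

lemma map_rf_const_add [simp]:
  fixes u v :: "complex falg"
  shows "Poly_Mapping.map rf_const (u + v) = Poly_Mapping.map rf_const u + Poly_Mapping.map rf_const v"
proof (rule poly_mapping_eqI)
  have l: "Poly_Mapping.lookup (Poly_Mapping.map rf_const w) k = rf_const (Poly_Mapping.lookup w k)"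
    for w :: "complex falg" and k
    by (simp add: Poly_Mapping.map.rep_eq rf_const_simps when_def)
  show "Poly_Mapping.lookup (Poly_Mapping.map rf_const (u + v)) k =
      Poly_Mapping.lookup (Poly_Mapping.map rf_const u + Poly_Mapping.map rf_const v) k" for k
    by (simp add: l lookup_add rf_const_simps)
qed

lemma map_rf_const_mult:
  fixes u v :: "complex falg"
  shows "Poly_Mapping.map rf_const (u * v) = Poly_Mapping.map rf_const u * Poly_Mapping.map rf_const v"
proof (induction u rule: poly_mapping_single_induct)
  case (single w a)
  show ?case
    by (induction v rule: poly_mapping_single_induct)
      (simp_all add: mult_single rf_const_simps distrib_left)
qed (simp_all add: distrib_right)

lemma map_rf_const_diff:
  fixes u v :: "complex falg"
  shows "Poly_Mapping.map rf_const (u - v) = Poly_Mapping.map rf_const u - Poly_Mapping.map rf_const v"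
  using map_rf_const_add[of "u - v" v] by (simp add: eq_diff_eq)

lemma map_rf_const_U_ideal:
  assumes "u \<in> U_ideal h"
  shows "Poly_Mapping.map rf_const u \<in> A_ideal h"
proof -
  let ?S = "u2_relators (rf_const h) \<union>
     {gvar gT - const rf_t, const (rf_mu ^ 2) - (const (rf_const h ^ 2) - 4 * casimir)}"
  let ?J = "{u. Poly_Mapping.map rf_const u \<in> A_ideal h}"
  note cl = genideal_closed[where S = ?S, folded A_ideal_def]
  have v: "Poly_Mapping.map rf_const (gvar g) = gvar g" for g
    by (simp add: gvar_def rf_const_simps)
  have c: "Poly_Mapping.map rf_const (const a) = const (rf_const a)" for a
    by (simp add: const_def)
  have "genideal Falg (u2_relators h) \<subseteq> ?J"
  proof (rule genideal_least)
    have "Poly_Mapping.map rf_const ` u2_relators h = u2_relators (rf_const h)"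
      by (simp add: u2_relators_def commutator_def map_rf_const_diff map_rf_const_mult v c)
    with genideal_superset[of ?S, folded A_ideal_def] show "u2_relators h \<subseteq> ?J" by blast
    show "0 \<in> ?J"
      using genideal_zero[of ?S, folded A_ideal_def] c[of 0] by (simp add: rf_const_simps)
  qed (auto simp: map_rf_const_mult intro: cl)
  with assms show ?thesis unfolding U_ideal_def by blast
qed

lemma U_to_A_class: "U_to_A h (U_class h u) = A_class h (Poly_Mapping.map rf_const u)"
proof -
  have "(\<lambda>v. A_class h (Poly_Mapping.map rf_const v)) ` U_class h u =
      {A_class h (Poly_Mapping.map rf_const u)}"
  proof (intro equalityI subsetI)
    fix c assume "c \<in> (\<lambda>v. A_class h (Poly_Mapping.map rf_const v)) ` U_class h u"
    then obtain v where v: "v - u \<in> U_ideal h" "c = A_class h (Poly_Mapping.map rf_const v)"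
      by (auto simp: mem_U_class_iff)
    have "A_class h (Poly_Mapping.map rf_const v) = A_class h (Poly_Mapping.map rf_const u)"
      unfolding A_class_eq_iff map_rf_const_diff[symmetric]
      using v(1) by (rule map_rf_const_U_ideal)
    with v(2) show "c \<in> {A_class h (Poly_Mapping.map rf_const u)}" by simp
  next
    have "u \<in> U_class h u"
      by (simp add: mem_U_class_iff genideal_zero[of "u2_relators h", folded U_ideal_def])
    then show "c \<in> (\<lambda>v. A_class h (Poly_Mapping.map rf_const v)) ` U_class h u"
      if "c \<in> {A_class h (Poly_Mapping.map rf_const u)}" for c
      using that by blast
  qed
  then show ?thesis by (simp add: U_to_A_def)
qed

end

(*
  Only Delta_0 survives on 1, where it gives 4 / hbar^2, so the action of the Laplacian on f is 4 / hbar^2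
  times the entry (1, 0) of f applied to Pi.  Since Pi is annihilated by a cubic with the three distinct
  roots lambda_0, lambda_+, lambda_-, its spectral projectors are the Lagrange polynomials in Pi, and
  their (1, 0) entries are 1/2 and -(1/4 +- hbar / (2 mu)).
*)
theory Submission
  imports Defs
begin

section \<open>Spectral projectors from a resolution of the identity\<close>

text \<open>By \<open>one\<close>, each vector is the sum of its images under \<open>P l\<close>,
  \<open>P a\<close> and \<open>P b\<close>, and by \<open>MP\<close> these images lie in the three
  eigenspaces. So the eigenspaces span, and the behaviour on eigenvectors demanded by
  \<open>spectral_projector\<close> determines a single matrix, which \<open>P l\<close> is.\<close>

lemma spectral_projector_eqI:
  fixes M :: "'k::field mat"
  assumes M: "M \<in> carrier_mat n n"
    and P: "\<And>x. x \<in> {l, a, b} \<Longrightarrow> P x \<in> carrier_mat n n"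
    and MP: "\<And>x. x \<in> {l, a, b} \<Longrightarrow> M * P x = x \<cdot>\<^sub>m P x"
    and PM: "\<And>x. x \<in> {l, a, b} \<Longrightarrow> P x * M = x \<cdot>\<^sub>m P x"
    and one: "P l + P a + P b = 1\<^sub>m n"
    and ne: "l \<noteq> a" "l \<noteq> b" "a \<noteq> b"
  shows "spectral_projector M l = P l"
proof -
  have n: "dim_row M = n" using M by simp
  have split: "v = P l *\<^sub>v v + P a *\<^sub>v v + P b *\<^sub>v v" if "v \<in> carrier_vec n" for v
  proof -
    have "v = (P l + P a + P b) *\<^sub>v v" using that by (simp add: one)
    also have "\<dots> = P l *\<^sub>v v + P a *\<^sub>v v + P b *\<^sub>v v"
      using that P by (simp add: add_mult_distrib_mat_vec[of _ n n])
    finally show ?thesis .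
  qed
  \<comment> \<open>Computing \<open>P x * M\<close> on an eigenvector in two ways gives
    \<open>k\<close> times and \<open>x\<close> times the same vector; as \<open>k\<close> differs
    from \<open>x\<close>, every coordinate is zero.\<close>
  have kill: "P x *\<^sub>v v = 0\<^sub>v n"
    if x: "x \<in> {l, a, b}" and v: "v \<in> carrier_vec n" and ev: "M *\<^sub>v v = k \<cdot>\<^sub>v v" and "k \<noteq> x"
    for x v k
  proof -
    have c: "P x *\<^sub>v v \<in> carrier_vec n" using P[OF x] v by simp
    have "k \<cdot>\<^sub>v (P x *\<^sub>v v) = P x *\<^sub>v (M *\<^sub>v v)"
      using P[OF x] v by (simp add: ev mult_mat_vec)
    also have "\<dots> = (P x * M) *\<^sub>v v"
      using P[OF x] M v by (simp add: assoc_mult_mat_vec)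
    also have "\<dots> = x \<cdot>\<^sub>v (P x *\<^sub>v v)"
      using P[OF x] v by (auto simp: PM[OF x])
    finally have eq: "k \<cdot>\<^sub>v (P x *\<^sub>v v) = x \<cdot>\<^sub>v (P x *\<^sub>v v)" .
    show ?thesis
    proof (rule eq_vecI)
      fix i assume "i < dim_vec (0\<^sub>v n :: 'k vec)"
      then have i: "i < dim_vec (P x *\<^sub>v v)" using P[OF x] by simp
      have "k * (P x *\<^sub>v v) $ i = x * (P x *\<^sub>v v) $ i"
        using arg_cong[OF eq, of "\<lambda>w. vec_index w i"] i carrier_matD[OF P[OF x]]
        by (simp del: index_mult_mat_vec)
      then show "(P x *\<^sub>v v) $ i = 0\<^sub>v n $ i"
        using \<open>k \<noteq> x\<close> i c carrier_matD[OF P[OF x]] by (simp del: index_mult_mat_vec)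
    qed (use P[OF x] in simp)
  qed
  have fixed: "P l *\<^sub>v v = v" if v: "v \<in> carrier_vec n" and ev: "M *\<^sub>v v = l \<cdot>\<^sub>v v" for v
    using split[OF v] kill[OF _ v ev, of a] kill[OF _ v ev, of b] ne P[of l] v
    by (simp add: right_zero_vec[of _ n])
  have image: "M *\<^sub>v (P x *\<^sub>v v) = x \<cdot>\<^sub>v (P x *\<^sub>v v)"
    if x: "x \<in> {l, a, b}" and v: "v \<in> carrier_vec n" for x v
    using P[OF x] v M by (auto simp: assoc_mult_mat_vec[symmetric] MP[OF x])
  show ?thesis
    unfolding spectral_projector_def n
  proof (rule the_equality)
    fix R assume R: "R \<in> carrier_mat n n \<and>
      (\<forall>v\<in>carrier_vec n. M *\<^sub>v v = l \<cdot>\<^sub>v v \<longrightarrow> R *\<^sub>v v = v) \<and>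
      (\<forall>k. \<forall>v\<in>carrier_vec n. k \<noteq> l \<longrightarrow> M *\<^sub>v v = k \<cdot>\<^sub>v v \<longrightarrow> R *\<^sub>v v = 0\<^sub>v n)"
    \<comment> \<open>Uniqueness: by \<open>image\<close> the three components of \<open>v\<close>
      satisfy the eigenvector equations for \<open>l\<close>, \<open>a\<close> and \<open>b\<close>,
      so \<open>R\<close> fixes the first and annihilates the other two.\<close>
    have "R *\<^sub>v v = P l *\<^sub>v v" if v: "v \<in> carrier_vec n" for v
    proof -
      have c: "P x *\<^sub>v v \<in> carrier_vec n" if "x \<in> {l, a, b}" for x using P[OF that] v by simp
      have "R *\<^sub>v v = R *\<^sub>v (P l *\<^sub>v v + P a *\<^sub>v v + P b *\<^sub>v v)" using split[OF v] by simp
      also have "\<dots> = R *\<^sub>v (P l *\<^sub>v v) + R *\<^sub>v (P a *\<^sub>v v) + R *\<^sub>v (P b *\<^sub>v v)"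
        using R c by (simp add: mult_add_distrib_mat_vec[of _ n n])
      also have "\<dots> = P l *\<^sub>v v"
      proof -
        have "R *\<^sub>v (P l *\<^sub>v v) = P l *\<^sub>v v" using R c[of l] image[OF _ v, of l] by simp
        moreover have "R *\<^sub>v (P a *\<^sub>v v) = 0\<^sub>v n" using R c[of a] image[OF _ v, of a] ne by auto
        moreover have "R *\<^sub>v (P b *\<^sub>v v) = 0\<^sub>v n" using R c[of b] image[OF _ v, of b] ne by auto
        ultimately show ?thesis using c[of l] by simp
      qed
      finally show ?thesis .
    qed
    then have unit: "(R *\<^sub>v unit_vec n j) $ i = (P l *\<^sub>v unit_vec n j) $ i" for i j by simp
    show "R = P l"
    proof (rule eq_matI)
      show "R $$ (i, j) = P l $$ (i, j)" if "i < dim_row (P l)" "j < dim_col (P l)" for i j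
        using unit[of j i] that conjunct1[OF R] P[of l] by simp
    qed (use R P[of l] in auto)
  qed (use P[of l] fixed kill[of l] in auto)
qed

text \<open>By Vieta's relations \<open>sym\<close>, the cubic is
  \<open>(M - l)(M - a)(M - b) = 0\<close>, so the Lagrange basis polynomials at the three distinct
  roots, evaluated at \<open>M\<close>, resolve the identity. The coefficients \<open>s1\<close>,
  \<open>s2\<close>, \<open>s3\<close> are separate parameters so that a cubic can be supplied
  before its roots are known.\<close>

lemma spectral_projector_cubic:
  fixes M :: "'k::field mat"
  assumes M: "M \<in> carrier_mat n n"
    and cubic: "M * (M * M) = s1 \<cdot>\<^sub>m (M * M) - s2 \<cdot>\<^sub>m M + s3 \<cdot>\<^sub>m 1\<^sub>m n"
    and sym: "s1 = l + a + b" "s2 = l * a + l * b + a * b" "s3 = l * a * b"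
    and ne: "l \<noteq> a" "l \<noteq> b" "a \<noteq> b"
  shows "spectral_projector M l =
    (1 / ((l - a) * (l - b))) \<cdot>\<^sub>m (M * M - (a + b) \<cdot>\<^sub>m M + (a * b) \<cdot>\<^sub>m 1\<^sub>m n)"
proof -
  let ?L = "\<lambda>x y. M * M - (x + y) \<cdot>\<^sub>m M + (x * y) \<cdot>\<^sub>m 1\<^sub>m n"
  define P where "P x = (if x = l then (1 / ((l - a) * (l - b))) \<cdot>\<^sub>m ?L a b
     else if x = a then (1 / ((a - l) * (a - b))) \<cdot>\<^sub>m ?L l b
     else (1 / ((b - l) * (b - a))) \<cdot>\<^sub>m ?L l a)" for x
  have MM: "M * M \<in> carrier_mat n n" using M by simp
  note dims = carrier_matD[OF M] carrier_matD[OF MM]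
  have c: "?L x y \<in> carrier_mat n n" for x y using M by simp
  have *: "M * M - (x + y) \<cdot>\<^sub>m M \<in> carrier_mat n n" "(x + y) \<cdot>\<^sub>m M \<in> carrier_mat n n"
      "(x * y) \<cdot>\<^sub>m 1\<^sub>m n \<in> carrier_mat n n" for x y
    using M by auto
  have L1: "M * ?L x y = M * (M * M) - (x + y) \<cdot>\<^sub>m (M * M) + (x * y) \<cdot>\<^sub>m M" for x y
    using M by (simp add: mult_add_distrib_mat[OF M *(1,3)] mult_minus_distrib_mat[OF M MM *(2)]
        mult_smult_distrib[OF M M] mult_smult_distrib[OF M one_carrier_mat])
  have L2: "?L x y * M = M * (M * M) - (x + y) \<cdot>\<^sub>m (M * M) + (x * y) \<cdot>\<^sub>m M" for x y
    using M by (simp add: add_mult_distrib_mat[OF *(1,3) M] minus_mult_distrib_mat[OF MM *(2) M]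
        mult_smult_assoc_mat[OF M M] mult_smult_assoc_mat[OF one_carrier_mat M] assoc_mult_mat[OF M M M])
  \<comment> \<open>The roots enter only through their symmetric functions, so \<open>x\<close>,
    \<open>y\<close>, \<open>z\<close> may be \<open>l\<close>, \<open>a\<close>, \<open>b\<close>
    in any order and one computation covers all three projectors.\<close>
  have L3: "M * (M * M) - (x + y) \<cdot>\<^sub>m (M * M) + (x * y) \<cdot>\<^sub>m M = z \<cdot>\<^sub>m ?L x y"
    if s: "x + y + z = l + a + b" "x * y + x * z + y * z = l * a + l * b + a * b" "x * y * z = l * a * b"
    for x y z
    unfolding cubic sym s[symmetric] using M
    by (intro eq_matI) (simp_all add: dims algebra_simps del: index_mult_mat(1))
  have MP: "M * (c \<cdot>\<^sub>m ?L x y) = z \<cdot>\<^sub>m (c \<cdot>\<^sub>m ?L x y)" "(c \<cdot>\<^sub>m ?L x y) * M = z \<cdot>\<^sub>m (c \<cdot>\<^sub>m ?L x y)"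
    if s: "x + y + z = l + a + b" "x * y + x * z + y * z = l * a + l * b + a * b" "x * y * z = l * a * b"
    for c x y z
    using mult_smult_distrib[OF M c, of c x y] mult_smult_assoc_mat[OF c M, of c x y]
      L1[of x y] L2[of x y] L3[OF s]
    by (auto intro!: eq_matI simp: dims mult.left_commute)
  have "spectral_projector M l = P l"
  proof (rule spectral_projector_eqI[where a = a and b = b, OF M])
    show "P x \<in> carrier_mat n n" for x using c by (simp add: P_def)
    show "M * P x = x \<cdot>\<^sub>m P x" "P x * M = x \<cdot>\<^sub>m P x" if "x \<in> {l, a, b}" for x
      using that ne unfolding P_def by (auto intro!: MP simp: algebra_simps)
    \<comment> \<open>The Lagrange basis polynomials sum to 1; \<open>u\<close>, \<open>v\<close>,
      \<open>w\<close> stand for corresponding entries of the square of \<open>M\<close>, of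
      \<open>M\<close> and of the identity.\<close>
    have alg: "1 / ((l - a) * (l - b)) * (u - (a + b) * v + a * b * w) +
        1 / ((a - l) * (a - b)) * (u - (l + b) * v + l * b * w) +
        1 / ((b - l) * (b - a)) * (u - (l + a) * v + l * a * w) = w" for u v w
    proof -
      have "l - a \<noteq> 0" "l - b \<noteq> 0" "a - b \<noteq> 0" "a - l \<noteq> 0" "b - l \<noteq> 0" "b - a \<noteq> 0"
        using ne by auto
      then show ?thesis by (simp add: divide_simps) (simp add: algebra_simps)
    qed
    show "P l + P a + P b = 1\<^sub>m n"
    proof (rule eq_matI)
      fix i j assume "i < dim_row (1\<^sub>m n :: 'k mat)" "j < dim_col (1\<^sub>m n :: 'k mat)"
      then show "(P l + P a + P b) $$ (i, j) = 1\<^sub>m n $$ (i, j)"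
        using ne alg[of "(M * M) $$ (i, j)" "M $$ (i, j)" "1\<^sub>m n $$ (i, j)"]
        by (simp add: P_def dims del: index_mult_mat(1) index_one_mat(1))
    qed (use ne in \<open>auto simp: P_def\<close>)
  qed (use ne in auto)
  then show ?thesis by (simp add: P_def)
qed

section \<open>The cubic equation of the matrix Pi\<close>

text \<open>
  \<open>\<Pi>\<close> in terms of \<open>g = \<hbar>/2\<close>, which clears its denominators and makes its entries polynomial in \<open>C\<close> and \<open>g\<close>.
\<close>

definition halved_Pi :: "'k::comm_ring_1 \<Rightarrow> 'k \<Rightarrow> 'k mat" where
  "halved_Pi C g = mat_of_rows_list 4
    [[C - 6 * g ^ 2, 2 * g ^ 2, - 4 * g, 0],
     [6 * g ^ 2, C - 2 * g ^ 2, 4 * g, 0],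
     [2 * g * C, 0, C - 2 * g ^ 2, - 2 * g],
     [4 * g ^ 2 * C, - 2 * g ^ 2 * C, 2 * g * (2 * C + g ^ 2), C + 2 * g ^ 2]]"

lemma halved_Pi_carrier: "halved_Pi C g \<in> carrier_mat 4 4"
  by (rule carrier_matI) (simp_all add: halved_Pi_def mat_of_rows_list_def)

lemma halved_Pi_index:
  assumes "i < 4" "j < 4"
  shows "halved_Pi C g $$ (i, j) =
    [[C - 6 * g ^ 2, 2 * g ^ 2, - 4 * g, 0],
     [6 * g ^ 2, C - 2 * g ^ 2, 4 * g, 0],
     [2 * g * C, 0, C - 2 * g ^ 2, - 2 * g],
     [4 * g ^ 2 * C, - 2 * g ^ 2 * C, 2 * g * (2 * C + g ^ 2), C + 2 * g ^ 2]] ! i ! j"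
  using assms by (simp add: halved_Pi_def mat_of_rows_list_def)

lemma mult_mat_4_index:
  fixes A B :: "'k::comm_ring_1 mat"
  assumes "A \<in> carrier_mat 4 4" "B \<in> carrier_mat 4 4" "i < 4" "j < 4"
  shows "(A * B) $$ (i, j) = A $$ (i, 0) * B $$ (0, j) + A $$ (i, 1) * B $$ (1, j) +
    A $$ (i, 2) * B $$ (2, j) + A $$ (i, 3) * B $$ (3, j)"
  using assms by (simp add: scalar_prod_def eval_nat_numeral)

text \<open>The cubic is \<open>(X - C) (X^2 - (2 C - 8 g^2) X + C^2 + 8 g^2 C)\<close>: the double
  eigenvalue \<open>C\<close> enters once, and the quadratic factor carries the other two. In
  \<open>C\<close> and \<open>g\<close> this is a polynomial identity in each of the sixteen
  entries.\<close>

lemma halved_Pi_cubic: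
  fixes C g :: "'k::comm_ring_1"
  defines "M \<equiv> halved_Pi C g"
  shows "M * (M * M) =
    (3 * C - 8 * g ^ 2) \<cdot>\<^sub>m (M * M) - (3 * C ^ 2) \<cdot>\<^sub>m M + (C ^ 3 + 8 * g ^ 2 * C ^ 2) \<cdot>\<^sub>m 1\<^sub>m 4"
    (is "_ = ?R")
proof (rule eq_matI)
  have M: "M \<in> carrier_mat 4 4" and MM: "M * M \<in> carrier_mat 4 4"
    by (simp_all add: M_def mult_carrier_mat[OF halved_Pi_carrier halved_Pi_carrier] halved_Pi_carrier)
  note d = carrier_matD[OF M] carrier_matD[OF MM]
  fix i j assume "i < dim_row ?R" "j < dim_col ?R"
  then have "i = 0 \<or> i = 1 \<or> i = 2 \<or> i = 3" "j = 0 \<or> j = 1 \<or> j = 2 \<or> j = 3" using d by auto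
  then show "(M * (M * M)) $$ (i, j) = ?R $$ (i, j)"
    by (elim disjE)
      \<comment> \<open>With \<open>index_mult_mat(1)\<close> disabled, entries of products expand
        into four explicit terms instead of scalar products.\<close>
      (simp_all add: d mult_mat_4_index[OF M MM] mult_mat_4_index[OF M M]
         halved_Pi_index[of _ _ C g, folded M_def] del: index_mult_mat(1),
       simp_all add: algebra_simps power2_eq_square power3_eq_cube power4_eq_xxxx)
qed (simp_all add: M_def carrier_matD[OF halved_Pi_carrier])

section \<open>Constants and the indeterminate mu in the field of rational functions\<close>

text \<open>Makes numerals such as 2, 4 and 8 nonzero in \<open>ratfun\<close>, so that they cancel
  from denominators.\<close>

instance fract :: ("{idom, ring_char_0}") field_char_0
proof
  show "inj (of_nat :: nat \<Rightarrow> 'a fract)"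
    by (rule injI) (simp add: of_nat_fract eq_fract)
qed

lemma rf_const_eq_iff: "rf_const a = rf_const b \<longleftrightarrow> a = b"
  by (simp add: rf_const_def eq_fract)

lemma rf_const_2: "rf_const 2 = 2"
  using rf_const_simps(3)[of 1 1] by (simp add: rf_const_simps)

lemma rf_const_divide: "b \<noteq> 0 \<Longrightarrow> rf_const (a / b) = rf_const a / rf_const b"
  using rf_const_simps(4)[of "a / b" b] rf_const_eq_iff[of b 0]
  by (simp add: rf_const_simps(1) field_simps)

text \<open>An indeterminate is not a constant. This keeps \<open>mu\<close>, \<open>mu + h\<close>
  and \<open>mu - h\<close> from vanishing, which is what separates the three eigenvalues.\<close>

lemma rf_mu_neq_const: "rf_mu \<noteq> rf_const c"
  by (simp add: rf_mu_def rf_const_def eq_fract)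

lemma Pi_mat_eq_halved_Pi: "Pi_mat hbar = halved_Pi (rf_Cas hbar) (rf_const (hbar / 2))"
proof -
  define g where "g = rf_const (hbar / 2)"
  have h: "rf_const hbar = 2 * g"
    by (simp add: g_def rf_const_divide rf_const_2)
  have "3 / 2 * (2 * g) ^ 2 = 6 * g ^ 2" "(2 * g) ^ 2 / 2 = 2 * g ^ 2" "(2 * g) ^ 2 / 4 = g ^ 2"
    and "(2 * g) ^ 2 = 4 * g ^ 2" "- (2 * g ^ 2) * rf_Cas hbar = - 2 * g ^ 2 * rf_Cas hbar"
    and "- 2 * (2 * g) = - 4 * g" "2 * (2 * g) = 4 * g" "- (2 * g) = - 2 * g"
    by (simp_all add: field_simps power2_eq_square)
  then show ?thesis
    unfolding Pi_mat_def Let_def h halved_Pi_def g_def[symmetric] by (simp only:)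
qed

section \<open>The entry (1, 0) of the projectors and of the transfer matrix\<close>

text \<open>The identity term of the Lagrange polynomial vanishes off the diagonal;
  \<open>20 * g ^ 2 * C - 48 * g ^ 4\<close> is the entry of the squared matrix and
  \<open>6 * g ^ 2\<close> that of the matrix itself.\<close>

lemma halved_Pi_spectral_projector:
  fixes C g l a b :: "'k::field"
  assumes "3 * C - 8 * g ^ 2 = l + a + b" "3 * C ^ 2 = l * a + l * b + a * b"
    and "C ^ 3 + 8 * g ^ 2 * C ^ 2 = l * a * b"
    and "l \<noteq> a" "l \<noteq> b" "a \<noteq> b"
  shows "spectral_projector (halved_Pi C g) l $$ (1, 0) =
    (20 * g ^ 2 * C - 48 * g ^ 4 - (a + b) * (6 * g ^ 2)) / ((l - a) * (l - b))"
    and "spectral_projector (halved_Pi C g) l \<in> carrier_mat 4 4"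
proof -
  have "(halved_Pi C g * halved_Pi C g) $$ (1, 0) = 20 * g ^ 2 * C - 48 * g ^ 4"
    by (simp add: mult_mat_4_index halved_Pi_carrier halved_Pi_index del: index_mult_mat(1))
      (simp add: algebra_simps power2_eq_square power4_eq_xxxx)
  moreover have "halved_Pi C g $$ (1, 0) = 6 * g ^ 2" by (simp add: halved_Pi_index)
  ultimately show "spectral_projector (halved_Pi C g) l $$ (1, 0) =
    (20 * g ^ 2 * C - 48 * g ^ 4 - (a + b) * (6 * g ^ 2)) / ((l - a) * (l - b))"
    unfolding spectral_projector_cubic[OF halved_Pi_carrier halved_Pi_cubic assms]
    by (simp add: carrier_matD[OF halved_Pi_carrier] del: index_mult_mat(1))
  show "spectral_projector (halved_Pi C g) l \<in> carrier_mat 4 4"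
    unfolding spectral_projector_cubic[OF halved_Pi_carrier halved_Pi_cubic assms] by simp
qed

lemma transfer_mat_index_1_0:
  fixes hbar :: complex and f :: ratfun
  assumes "hbar \<noteq> 0"
  defines "h \<equiv> rf_const hbar"
  defines "F \<equiv> rf_subst f (rf_t + h)"
  shows "transfer_mat hbar f $$ (1, 0) = F rf_mu / 2 - F (rf_mu + 2 * h) * (1 / 4 + h / (2 * rf_mu)) -
    F (rf_mu - 2 * h) * (1 / 4 - h / (2 * rf_mu))"
proof -
  \<comment> \<open>Halving both \<open>h\<close> and \<open>mu\<close> absorbs the factor 1/4: the
    eigenvalues become \<open>g^2 - m^2\<close> and \<open>g^2 - (m +- 2 g)^2\<close>.\<close>
  define g where "g = rf_const (hbar / 2)"
  define m where "m = rf_mu / 2"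
  have h: "h = 2 * g" by (simp add: h_def g_def rf_const_divide rf_const_2)
  have mu: "rf_mu = 2 * m" by (simp add: m_def)
  have g0: "g \<noteq> 0" using assms(1) rf_const_eq_iff[of "hbar / 2" 0] by (simp add: g_def rf_const_simps(1))
  have m0: "m \<noteq> 0" using rf_mu_neq_const[of 0] by (simp add: m_def rf_const_simps(1))
  have mg: "m + g \<noteq> 0"
  proof
    assume "m + g = 0"
    then have "rf_mu = 2 * rf_const (- (hbar / 2))"
      using rf_const_simps(3)[of "hbar / 2" "- (hbar / 2)"]
      unfolding mu g_def by (simp add: rf_const_simps(1) add_eq_0_iff)
    then show False using rf_mu_neq_const[of "2 * - (hbar / 2)"] by (metis rf_const_simps(4) rf_const_2)
  qed
  have mg': "m - g \<noteq> 0"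
  proof
    assume "m - g = 0"
    then have "rf_mu = rf_const hbar" by (simp add: mu h[unfolded h_def])
    then show False by (simp add: rf_mu_neq_const)
  qed
  define C l a b where "C = rf_Cas hbar" and "l = branch_eigenvalue hbar rf_mu"
    and "a = branch_eigenvalue hbar (rf_mu + 2 * h)" and "b = branch_eigenvalue hbar (rf_mu - 2 * h)"
  have q: "((2 * x) ^ 2 - (2 * y) ^ 2) / 4 = x ^ 2 - y ^ 2" for x y :: ratfun
    by (simp add: field_simps power2_eq_square)
  have C: "C = g ^ 2 - m ^ 2"
    using q[of g m] by (simp add: C_def rf_Cas_def h[unfolded h_def] mu)
  have l: "l = g ^ 2 - m ^ 2"
    using q[of g m] by (simp add: l_def branch_eigenvalue_def h[unfolded h_def] mu)
  have a: "a = g ^ 2 - (m + 2 * g) ^ 2"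
    using q[of g "m + 2 * g"] by (simp add: a_def branch_eigenvalue_def h h[unfolded h_def] mu distrib_left)
  have b: "b = g ^ 2 - (m - 2 * g) ^ 2"
    using q[of g "m - 2 * g"] by (simp add: b_def branch_eigenvalue_def h h[unfolded h_def] mu right_diff_distrib)
  \<comment> \<open>Differences of squares factor, so the eigenvalues are distinct once
    \<open>g\<close>, \<open>m\<close>, \<open>m + g\<close> and \<open>m - g\<close> are
    nonzero.\<close>
  have la: "l - a = 4 * g * (m + g)"
    unfolding l a by (simp add: algebra_simps power2_eq_square)
  have lb: "l - b = - (4 * g * (m - g))"
    unfolding l b by (simp add: algebra_simps power2_eq_square)
  have ab: "a - b = - (8 * g * m)"
    unfolding a b by (simp add: algebra_simps power2_eq_square)
  have al: "a - l = - (4 * g * (m + g))" and bl: "b - l = 4 * g * (m - g)" and ba: "b - a = 8 * g * m"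
    using la lb ab by (simp_all add: algebra_simps)
  have nz: "4 * g * (m + g) \<noteq> 0" "4 * g * (m - g) \<noteq> 0" "8 * g * m \<noteq> 0"
    using g0 m0 mg mg' by auto
  then have ne: "l \<noteq> a" "l \<noteq> b" "a \<noteq> b" "a \<noteq> l" "b \<noteq> l" "b \<noteq> a"
    using la lb ab by auto
  have sym: "3 * C - 8 * g ^ 2 = l + a + b" "3 * C ^ 2 = l * a + l * b + a * b"
      "C ^ 3 + 8 * g ^ 2 * C ^ 2 = l * a * b"
    unfolding C l a b by (simp_all add: algebra_simps power2_eq_square power3_eq_cube)
  note projector = halved_Pi_spectral_projector[of C g, folded Pi_mat_eq_halved_Pi[of hbar, folded C_def g_def]]
  \<comment> \<open>Vieta's relations are symmetric in the roots, so the entry formula may be used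
    with \<open>a\<close>, and then \<open>b\<close>, as the distinguished root.\<close>
  have *: "spectral_projector (Pi_mat hbar) a $$ (1, 0) =
        (20 * g ^ 2 * C - 48 * g ^ 4 - (l + b) * (6 * g ^ 2)) / ((a - l) * (a - b))"
      "spectral_projector (Pi_mat hbar) a \<in> carrier_mat 4 4"
    by (rule projector; use sym ne in \<open>simp add: ac_simps\<close>)+
  have **: "spectral_projector (Pi_mat hbar) b $$ (1, 0) =
        (20 * g ^ 2 * C - 48 * g ^ 4 - (l + a) * (6 * g ^ 2)) / ((b - l) * (b - a))"
      "spectral_projector (Pi_mat hbar) b \<in> carrier_mat 4 4"
    by (rule projector; use sym ne in \<open>simp add: ac_simps\<close>)+
  have "spectral_projector (Pi_mat hbar) l $$ (1, 0) = 1 / 2"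
  proof -
    \<comment> \<open>Numerator and denominator share \<open>m + g\<close> and \<open>m - g\<close>.
      Writing \<open>p\<close> and \<open>q\<close> for them keeps the factors from being multiplied
      out before they cancel; the other two projectors are treated alike.\<close>
    have "- (8 * g ^ 2 * p * q) / (4 * g * p * - (4 * g * q)) = 1 / 2" if "p \<noteq> 0" "q \<noteq> 0" for p q
      using that g0 by (simp add: power2_eq_square)
    note cancel = this[OF mg mg']
    have "20 * g ^ 2 * C - 48 * g ^ 4 - (a + b) * (6 * g ^ 2) = - (8 * g ^ 2 * (m + g) * (m - g))"
      unfolding C a b by (simp add: algebra_simps power2_eq_square power4_eq_xxxx)
    then show ?thesis
      unfolding projector(1)[OF sym ne(1-3)] la lb by (simp only: cancel)
  qed
  moreover have "spectral_projector (Pi_mat hbar) a $$ (1, 0) = - (1 / 4 + h / (2 * rf_mu))"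
  proof -
    have "- (8 * g ^ 2 * p * (m + 2 * g)) / (- (4 * g * p) * - (8 * g * m)) =
        - (1 / 4 + 2 * g / (2 * (2 * m)))" if "p \<noteq> 0" for p
      using that g0 m0 by (simp add: field_simps power2_eq_square)
    note cancel = this[OF mg]
    have "20 * g ^ 2 * C - 48 * g ^ 4 - (l + b) * (6 * g ^ 2) = - (8 * g ^ 2 * (m + g) * (m + 2 * g))"
      unfolding C l b by (simp add: algebra_simps power2_eq_square power4_eq_xxxx)
    then show ?thesis
      unfolding *(1) al ab h mu by (simp only: cancel)
  qed
  moreover have "spectral_projector (Pi_mat hbar) b $$ (1, 0) = - (1 / 4 - h / (2 * rf_mu))"
  proof -
    have "- (8 * g ^ 2 * q * (m - 2 * g)) / (4 * g * q * (8 * g * m)) =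
        - (1 / 4 - 2 * g / (2 * (2 * m)))" if "q \<noteq> 0" for q
      using that g0 m0 by (simp add: field_simps power2_eq_square)
    note cancel = this[OF mg']
    have "20 * g ^ 2 * C - 48 * g ^ 4 - (l + a) * (6 * g ^ 2) = - (8 * g ^ 2 * (m - g) * (m - 2 * g))"
      unfolding C l a by (simp add: algebra_simps power2_eq_square power4_eq_xxxx)
    then show ?thesis
      unfolding **(1) bl ba h mu by (simp only: cancel)
  qed
  moreover have "transfer_mat hbar f $$ (1, 0) =
      F rf_mu * spectral_projector (Pi_mat hbar) l $$ (1, 0) +
      F (rf_mu + 2 * h) * spectral_projector (Pi_mat hbar) a $$ (1, 0) +
      F (rf_mu - 2 * h) * spectral_projector (Pi_mat hbar) b $$ (1, 0)"
    using *(2) **(2) projector(2)[OF sym ne(1-3)]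
    by (simp add: transfer_mat_def F_def a_def b_def l_def h_def)
  ultimately show ?thesis
    by (simp only: mult_minus_right times_divide_eq_right mult_1_right add_uminus_conv_diff)
qed

section \<open>Values on the unit and sums in the extended algebra\<close>

text \<open>A derivative multiplies a constant by its \<open>counit\<close>, which is
  \<open>2 / h\<close> for the shifted derivative \<open>DT\<close> and zero for the others. All
  operators except the one with index 0 apply \<open>DX\<close>, \<open>DY\<close> or
  \<open>DZ\<close> to a constant.\<close>

lemma Delta_one:
  assumes "j < 4"
  shows "Delta h j \<one>\<^bsub>U h\<^esub> = U_class h (const (if j = 0 then (2 / h) ^ 2 else 0))"
proof -
  have c: "pd h D (U_class h (const x)) = U_class h (const (x * counit h D))" for D x
    by (simp add: pd_class pd_free_const)
  \<comment> \<open>Covers derivatives of an inner result that is zero: \<open>const 0\<close>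
    simplifies to \<open>0\<close>, which \<open>c\<close> no longer matches.\<close>
  moreover have "pd h D (U_class h 0) = U_class h 0" for D
    using c[of D 0] by simp
  moreover have "j = 0 \<or> j = 1 \<or> j = 2 \<or> j = 3" using assms by auto
  ultimately show ?thesis
    by (auto simp: Delta_def laplacian_def Qop_def pd_one counit_def U_class_add U_class_mult
        power2_eq_square)
qed

lemma A_class_add: "A_class h u \<oplus>\<^bsub>A h\<^esub> A_class h v = A_class h (u + v)"
proof -
  interpret ideal "A_ideal h" "Falg :: ratfun falg ring" unfolding A_ideal_def by (rule genideal_Falg)
  show ?thesis
    using a_rcos_sum[of u v] by (simp add: A_class_def A_def FactRing_def Falg_simps)
qed

lemma A_class_mult: "A_class h u \<otimes>\<^bsub>A h\<^esub> A_class h v = A_class h (u * v)"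
proof -
  interpret ideal "A_ideal h" "Falg :: ratfun falg ring" unfolding A_ideal_def by (rule genideal_Falg)
  show ?thesis
    using rcoset_mult_add[of u v] by (simp add: A_class_def A_def FactRing_def Falg_simps)
qed

lemma map_rf_const_const: "Poly_Mapping.map rf_const (const c) = const (rf_const c)"
  by (simp add: const_def)

lemma A_ring: "ring (A h)"
  unfolding A_def A_ideal_def by (rule ideal.quotient_is_ring) (rule genideal_Falg)

lemma A_class_carrier: "A_class h u \<in> carrier (A h)"
  by (auto simp: A_def FactRing_def A_RCOSETS_def' A_class_def Falg_simps)

text \<open>In an additive group only zero is unchanged when added to itself.\<close>

lemma A_zero: "\<zero>\<^bsub>A h\<^esub> = A_class h 0"
proof -
  interpret ring "A h" by (rule A_ring)
  show ?thesis
    using A_class_add[of h 0 0] A_class_carrier[of h 0] by (metis add.r_cancel_one' add_0)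
qed

lemma A_class_finsum:
  assumes "finite S"
  shows "(\<Oplus>\<^bsub>A h\<^esub> j \<in> S. A_class h (u j)) = A_class h (sum u S)"
proof -
  interpret ring "A h" by (rule A_ring)
  from assms show ?thesis
    by induction (simp_all add: finsum_insert A_zero A_class_add A_class_carrier)
qed

text \<open>By \<open>Delta_one\<close> the sum over \<open>j\<close> collapses to
  \<open>j = 0\<close>, so the action reads off one entry of the first column of the transfer
  matrix.\<close>

lemma rf_action_eq:
  assumes "h \<noteq> 0"
  shows "rf_action h i f = rf_to_A h (transfer_mat h f $$ (i, 0) * (4 / rf_const h ^ 2))"
proof -
  interpret ring "A h" by (rule A_ring)
  have "rf_const ((2 / h) ^ 2) = 4 / rf_const h ^ 2"
    unfolding power2_eq_square rf_const_simps(4) rf_const_divide[OF assms] rf_const_2 by simp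
  then have "rf_to_A h (transfer_mat h f $$ (i, j)) \<otimes>\<^bsub>A h\<^esub> U_to_A h (Delta h j \<one>\<^bsub>U h\<^esub>) =
      A_class h (const (transfer_mat h f $$ (i, j) * (if j = 0 then 4 / rf_const h ^ 2 else 0)))"
    if "j \<in> {0..<4}" for j
    using that unfolding rf_to_A_def
    by (subst Delta_one)
      (simp_all add: U_to_A_class A_class_mult const_mult[symmetric] rf_const_simps(1)
        map_rf_const_const del: times_divide_eq_right)
  then have "rf_action h i f = (\<Oplus>\<^bsub>A h\<^esub> j \<in> {0..<4}.
      A_class h (const (transfer_mat h f $$ (i, j) * (if j = 0 then 4 / rf_const h ^ 2 else 0))))"
    unfolding rf_action_def
    by (intro finsum_cong') (auto simp: A_class_carrier)
  then show ?thesis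
    by (simp add: A_class_finsum rf_to_A_def eval_nat_numeral)
qed

theorem mainTheorem6:
  fixes hbar :: complex and f :: ratfun
  assumes "hbar \<noteq> 0"
  shows "let h = rf_const hbar; t = rf_t; \<mu> = rf_mu; F = rf_subst f in
    rf_action hbar 1 f =
    rf_to_A hbar
      (1 / h ^ 2 * (2 * F (t + h) \<mu> - F (t + h) (\<mu> - 2 * h) - F (t + h) (\<mu> + 2 * h))
       + 2 / (\<mu> * h) * (F (t + h) (\<mu> - 2 * h) - F (t + h) (\<mu> + 2 * h)))"
proof -
  define h where "h = rf_const hbar"
  define F where "F = rf_subst f (rf_t + h)"
  have nz: "rf_mu \<noteq> 0" "h \<noteq> 0"
    using rf_mu_neq_const[of 0] rf_const_eq_iff[of hbar 0] assms
    by (simp_all add: h_def rf_const_simps(1))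
  \<comment> \<open>The three weights of the transfer entry, each multiplied by the value
    \<open>4 / h ^ 2\<close> of the surviving operator on 1.\<close>
  have w: "1 / 2 * (4 / h ^ 2) = 2 / h ^ 2"
      "(1 / 4 + h / (2 * rf_mu)) * (4 / h ^ 2) = 1 / h ^ 2 + 2 / (rf_mu * h)"
      "(1 / 4 - h / (2 * rf_mu)) * (4 / h ^ 2) = 1 / h ^ 2 - 2 / (rf_mu * h)"
    using nz by (simp_all add: field_simps power2_eq_square)
  have "transfer_mat hbar f $$ (1, 0) * (4 / h ^ 2) =
      F rf_mu * (1 / 2 * (4 / h ^ 2)) - F (rf_mu + 2 * h) * ((1 / 4 + h / (2 * rf_mu)) * (4 / h ^ 2)) -
      F (rf_mu - 2 * h) * ((1 / 4 - h / (2 * rf_mu)) * (4 / h ^ 2))"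
    unfolding transfer_mat_index_1_0[OF assms] F_def h_def by (simp add: algebra_simps)
  also have "\<dots> = 1 / h ^ 2 * (2 * F rf_mu - F (rf_mu - 2 * h) - F (rf_mu + 2 * h)) +
      2 / (rf_mu * h) * (F (rf_mu - 2 * h) - F (rf_mu + 2 * h))"
    unfolding w by (simp add: algebra_simps)
  finally show ?thesis
    unfolding Let_def rf_action_eq[OF assms] F_def h_def by simp
qed

end
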